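(* Consider the control problem of the neural ODE: minimize over $\theta$ the cost $L(z(t_f))\in\mathbb{R}$ subject to $\dot z(t)=f(t,z(t),\theta(t))$ on $[t_0,t_f]$, where $z(t)\in\mathbb{R}^N$ and $\theta(t)\in\mathbb{R}^P$, and where: (1) the initial value $z(t_0)$ is a given constant, independent of $\theta$; (2) the initial time $t_0$ and the end time $t_f$ are fixed and the end point $z(t_f)$ is free; (3) $\theta(t)\equiv\theta$ does not change with time. Let the multiplier $a(t)$ be chosen as the solution of $$\dot a(t)=-a(t)\,\frac{\partial f}{\partial z},\qquad a(t_f)=-\frac{\partial L}{\partial z(t_f)},$$ with the derivatives evaluated along the trajectory $z(t)$ belonging to the parameter $\theta$. Then $$a(t)=-\frac{\partial L}{\partial z},$$ where $\frac{\partial L}{\partial z}=\frac{\partial L}{\partial z(t)}$ is the derivative of the cost $L(z(t_f))$ with respect to the trajectory value $z(t)$ at time $t$.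
   Context: The multiplier $a(t)$ is the row-vector valued (size $1\times N$) Lagrange multiplier in the Lagrange cost $J(\theta)=L(z(t_f))+\int_{t_0}^{t_f}a(t)\bigl(\dot z(t)-f(t,z(t),\theta(t))\bigr)\,dt$. In $\frac{\partial L}{\partial z(t)}$ the later state $z(t_f)$, and hence $L$, is regarded as a function of the state $z(t)$ through the ODE $\dot z=f(t,z,\theta)$, so that $\frac{\partial L}{\partial z(t)}=\frac{\partial L}{\partial z(t+\epsilon)}\frac{\partial z(t+\epsilon)}{\partial z(t)}$. Derivatives follow the convention $\bigl(\frac{\partial g}{\partial x}\bigr)_{ij}=\frac{\partial g_i}{\partial x_j}$, so the derivative of a scalar function is a row vector. As in the source, the functions $f$ and $L$ are treated formally, with no explicit regularity assumptions. *)

theory Defs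
  imports "HOL-Analysis.Analysis"
begin

text \<open>Row vectors of size \<open>1 \<times> N\<close> are represented by \<open>real ^ 'n\<close> and act on matrices from the left
  by \<open>v*\<close>. The library's \<^const>\<open>jacobian\<close> has entry \<open>(i, j)\<close> equal to the derivative of the
  \<open>i\<close>-th component in the \<open>j\<close>-th variable; the following is its one-row counterpart for
  scalar functions.\<close>

definition row_derivative :: "(real ^ 'n \<Rightarrow> real) \<Rightarrow> real ^ 'n \<Rightarrow> real ^ 'n" where
  "row_derivative g x = (\<chi> j. frechet_derivative g (at x) (axis j 1))"

text \<open>At the end points of \<open>{s..e}\<close> the derivative is one-sided.\<close>

definition solves_ivp ::
    "(real \<Rightarrow> real ^ 'n \<Rightarrow> real ^ 'p \<Rightarrow> real ^ 'n) \<Rightarrow> (real \<Rightarrow> real ^ 'p)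
      \<Rightarrow> real \<Rightarrow> real \<Rightarrow> real ^ 'n \<Rightarrow> (real \<Rightarrow> real ^ 'n) \<Rightarrow> bool" where
  "solves_ivp f \<theta> s e x w \<longleftrightarrow>
     w s = x \<and>
     (\<forall>r\<in>{s..e}. (w has_vector_derivative f r (w r) (\<theta> r)) (at r within {s..e}))"

text \<open>The state at time \<open>e\<close> as a function of the state \<open>x\<close> at time \<open>s\<close>. It is meaningful only
  where the initial value problem has a solution on \<open>{s..e}\<close> with a unique end value. For \<open>f\<close>
  continuous and continuously differentiable in the state this holds for all \<open>x\<close> near a point
  of a solution that exists up to time \<open>e\<close>.\<close>

definition end_state ::
    "(real \<Rightarrow> real ^ 'n \<Rightarrow> real ^ 'p \<Rightarrow> real ^ 'n) \<Rightarrow> (real \<Rightarrow> real ^ 'p)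
      \<Rightarrow> real \<Rightarrow> real \<Rightarrow> real ^ 'n \<Rightarrow> real ^ 'n" where
  "end_state f \<theta> s e x = (THE y. \<exists>w. solves_ivp f \<theta> s e x w \<and> w e = y)"

definition cost_from_state ::
    "(real \<Rightarrow> real ^ 'n \<Rightarrow> real ^ 'p \<Rightarrow> real ^ 'n) \<Rightarrow> (real \<Rightarrow> real ^ 'p)
      \<Rightarrow> (real ^ 'n \<Rightarrow> real) \<Rightarrow> real \<Rightarrow> real \<Rightarrow> real ^ 'n \<Rightarrow> real" where
  "cost_from_state f \<theta> L e s x = L (end_state f \<theta> s e x)"

end

theory Submission
  imports Defs
begin

text \<open>Let \<open>w\<close> be a solution starting at time \<open>s\<close> near the trajectory \<open>z\<close>. By the adjoint equation
  the linear part of the derivative of \<open>a r \<bullet> (w r - z r)\<close> vanishes, so this pairing is constant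
  up to \<open>o(\<bar>w s - z s\<bar>)\<close>: the linearization of \<open>f\<close> has a uniformly small error, and \<open>\<bar>w r - z r\<bar>\<close> is
  bounded by a multiple of \<open>\<bar>w s - z s\<bar>\<close> by Gronwall's inequality. At the end time the pairing is
  minus the linear part of the change in cost, so at time \<open>s\<close> it is minus the derivative of the cost
  with respect to \<open>z s\<close>.\<close>

section \<open>Gronwall's inequality\<close>

text \<open>Working with \<open>d q \<bullet> d q\<close> avoids the zeros of \<open>d\<close>,
  where the norm need not be differentiable. By Cauchy-Schwarz the derivative of this square is at
  most \<open>2 * M\<close> times the square itself, so the weight
  \<open>exp (- 2 * M * (q - s))\<close> makes it nonincreasing. A square root at the end gives the
  bound.\<close>

lemma gronwall_norm:
  fixes d :: "real \<Rightarrow> 'a::real_inner"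
  assumes deriv: "\<And>r. r \<in> {s..e} \<Longrightarrow> (d has_vector_derivative d' r) (at r within {s..e})"
    and bound: "\<And>r. r \<in> {s..e} \<Longrightarrow> norm (d' r) \<le> M * norm (d r)"
    and r: "r \<in> {s..e}"
  shows "norm (d r) \<le> norm (d s) * exp (M * (r - s))"
proof -
  let ?\<phi> = "\<lambda>q. (d q \<bullet> d q) * exp (- 2 * M * (q - s))"
  let ?\<phi>' = "\<lambda>q. (2 * (d q \<bullet> d' q) - 2 * M * (d q \<bullet> d q)) * exp (- 2 * M * (q - s))"
  have \<phi>: "(?\<phi> has_real_derivative ?\<phi>' q) (at q within {s..e})" if "q \<in> {s..e}" for q
    using deriv[OF that] unfolding has_vector_derivative_def has_field_derivative_def
    by (auto intro!: derivative_eq_intros simp: algebra_simps inner_commute)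
  have "?\<phi> r \<le> ?\<phi> s"
  \<comment> \<open>This form of the monotonicity criterion asks for two-sided derivatives at
    interior points only, where they agree with derivatives within \<open>{s..e}\<close>; at the end
    points continuity suffices.\<close>
  proof (rule DERIV_nonpos_imp_decreasing_open[of s r ?\<phi>])
    show "s \<le> r" using r by simp
    have "continuous_on {s..e} ?\<phi>"
      by (rule DERIV_continuous_on) (rule \<phi>)
    then show "continuous_on {s..r} ?\<phi>"
      by (rule continuous_on_subset) (use r in auto)
    fix q assume q: "s < q" "q < r"
    have "at q within {s..e} = at q"
      using q r by (intro at_within_interior) auto
    then have "(?\<phi> has_real_derivative ?\<phi>' q) (at q)"
      using \<phi>[of q] q r by auto
    moreover have "?\<phi>' q \<le> 0"
    proof -
      have "d q \<bullet> d' q \<le> norm (d q) * norm (d' q)" by (rule norm_cauchy_schwarz)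
      also have "\<dots> \<le> norm (d q) * (M * norm (d q))"
        using bound[of q] q r by (intro mult_left_mono) auto
      finally have "d q \<bullet> d' q \<le> M * (d q \<bullet> d q)"
        by (simp add: dot_square_norm power2_eq_square algebra_simps)
      then show ?thesis by (intro mult_nonpos_nonneg) auto
    qed
    ultimately show "\<exists>y. (?\<phi> has_real_derivative y) (at q) \<and> y \<le> 0" by blast
  qed
  then have "(d r \<bullet> d r) * exp (- (2 * M * (r - s))) \<le> d s \<bullet> d s" by simp
  then have "d r \<bullet> d r \<le> (d s \<bullet> d s) * exp (2 * M * (r - s))"
    by (simp add: exp_minus pos_divide_le_eq flip: divide_inverse)
  also have "\<dots> = (norm (d s) * exp (M * (r - s)))\<^sup>2"
    by (simp add: dot_square_norm power_mult_distrib exp_double[symmetric] algebra_simps)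
  finally show ?thesis
    by (simp add: dot_square_norm power2_le_iff_abs_le)
qed

section \<open>Existence of solutions for globally Lipschitz fields\<close>

text \<open>The antiderivative contributes \<open>- 1 / k\<close> at the lower limit, which is
  dropped. The gained factor \<open>1 / k\<close> is what turns a Lipschitz constant
  \<open>M\<close> into the contraction factor \<open>M / k\<close>.\<close>

lemma integral_exp_scaled_le:
  fixes k :: real
  assumes "k > 0" "s \<le> r"
  shows "integral {s..r} (\<lambda>q. exp (k * (q - s))) \<le> exp (k * (r - s)) / k"
proof -
  have "((\<lambda>q. exp (k * (q - s))) has_integral
      (exp (k * (r - s)) / k - exp (k * (s - s)) / k)) {s..r}"
    by (rule fundamental_theorem_of_calculus)
      (use assms in \<open>auto intro!: derivative_eq_intros
        simp: has_real_derivative_iff_has_vector_derivative[symmetric]\<close>)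
  then show ?thesis using assms by (simp add: integral_unique)
qed

text \<open>The Picard operator acts on \<open>v r = exp (- k * (r - s)) *\<^sub>R w r\<close> instead of on the solution
  \<open>w\<close>; with \<open>k > M\<close> it is a contraction on the whole interval at once.\<close>

lemma ivp_exists_lipschitz:
  fixes F :: "real \<Rightarrow> 'a::banach \<Rightarrow> 'a"
  assumes se: "s \<le> e"
    and cont: "continuous_on ({s..e} \<times> UNIV) (\<lambda>(t, x). F t x)"
    and lip: "\<And>r x y. r \<in> {s..e} \<Longrightarrow> norm (F r x - F r y) \<le> M * norm (x - y)"
    and M: "M \<ge> 0"
  obtains w where "w s = \<xi>"
    and "\<And>r. r \<in> {s..e} \<Longrightarrow> (w has_vector_derivative F r (w r)) (at r within {s..e})"
proof -
  \<comment> \<open>Any \<open>k > M\<close> would do; this choice is positive even for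
    \<open>M = 0\<close>.\<close>
  define k where "k = M + 1"
  have k: "k > 0" "M / k < 1" using M by (auto simp: k_def)
  define G where "G v q = F q (exp (k * (q - s)) *\<^sub>R v q)" for v :: "real \<Rightarrow> 'a" and q
  define P where "P v r = exp (- k * (r - s)) *\<^sub>R (\<xi> + integral {s..r} (G v))" for v r
  have G_cont: "continuous_on {s..e} (G v)" if "continuous_on {s..e} v" for v
    unfolding G_def
    by (rule continuous_on_compose2[OF cont, where f = "\<lambda>q. (q, exp (k * (q - s)) *\<^sub>R v q)", simplified])
      (auto intro!: continuous_intros that)
  have I_deriv: "((\<lambda>r. integral {s..r} (G v)) has_vector_derivative G v r) (at r within {s..e})"
    if "continuous_on {s..e} v" "r \<in> {s..e}" for v r
    using that G_cont by (intro integral_has_vector_derivative) auto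
  have P_cont: "continuous_on {s..e} (P v)" if "continuous_on {s..e} v" for v
    unfolding P_def
    by (intro continuous_intros continuous_on_vector_derivative) (rule I_deriv[OF that])
  \<comment> \<open>Clamping the argument extends \<open>P v\<close> constantly beyond
    \<open>{s..e}\<close>. The result is bounded and continuous on the whole line, so the fixed
    point can be sought in the complete space of such functions.\<close>
  have "\<exists>g :: real \<Rightarrow>\<^sub>C 'a. \<forall>x. g x = P v (clamp s e x)" for v :: "real \<Rightarrow>\<^sub>C 'a"
  proof -
    have "continuous_on (cbox s e) (P v)" using P_cont[of v] by simp
    then show ?thesis by (rule continuous_on_cbox_bcontfunE) blast
  qed
  then obtain T :: "(real \<Rightarrow>\<^sub>C 'a) \<Rightarrow> (real \<Rightarrow>\<^sub>C 'a)"
    where T: "\<And>v x. T v x = P v (clamp s e x)" by metis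
  \<comment> \<open>The integrands differ by at most
    \<open>M * dist u v * exp (k * (q - s))\<close>. Integration gains \<open>1 / k\<close>, and the
    weight in front of the integral in \<open>P\<close> cancels the remaining exponential, so the
    length of the interval does not enter.\<close>
  have P_contr: "dist (P u r) (P v r) \<le> M / k * dist u v" if r: "r \<in> {s..e}" for u v :: "real \<Rightarrow>\<^sub>C 'a" and r
  proof -
    have int: "G v integrable_on {s..r}" for v :: "real \<Rightarrow>\<^sub>C 'a"
      using r by (intro integrable_continuous_real continuous_on_subset[OF G_cont]) auto
    have "norm (integral {s..r} (G u) - integral {s..r} (G v))
        = norm (integral {s..r} (\<lambda>q. G u q - G v q))"
      using int by (simp add: integral_diff)
    also have "\<dots> \<le> integral {s..r} (\<lambda>q. M * dist u v * exp (k * (q - s)))"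
    proof (rule integral_norm_bound_integral)
      show "(\<lambda>q. G u q - G v q) integrable_on {s..r}" using int by (intro integrable_diff)
      show "(\<lambda>q. M * dist u v * exp (k * (q - s))) integrable_on {s..r}"
        by (intro integrable_continuous_real continuous_intros)
      fix q assume q: "q \<in> {s..r}"
      have "norm (G u q - G v q)
          \<le> M * norm (exp (k * (q - s)) *\<^sub>R u q - exp (k * (q - s)) *\<^sub>R v q)"
        unfolding G_def using q r by (intro lip) auto
      also have "\<dots> = M * (exp (k * (q - s)) * dist (u q) (v q))"
        by (simp add: dist_norm scaleR_diff_right[symmetric])
      also have "\<dots> \<le> M * (exp (k * (q - s)) * dist u v)"
        using M by (intro mult_left_mono dist_bounded) auto
      finally show "norm (G u q - G v q) \<le> M * dist u v * exp (k * (q - s))"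
        by (simp add: mult_ac)
    qed
    also have "\<dots> = M * dist u v * integral {s..r} (\<lambda>q. exp (k * (q - s)))"
      by simp
    also have "\<dots> \<le> M * dist u v * (exp (k * (r - s)) / k)"
      using M r k by (intro mult_left_mono integral_exp_scaled_le) auto
    finally have *: "norm (integral {s..r} (G u) - integral {s..r} (G v))
      \<le> M * dist u v * (exp (k * (r - s)) / k)" .
    have "dist (P u r) (P v r)
        = exp (- k * (r - s)) * norm (integral {s..r} (G u) - integral {s..r} (G v))"
      by (simp add: P_def dist_norm scaleR_diff_right[symmetric])
    also have "\<dots> \<le> exp (- k * (r - s)) * (M * dist u v * (exp (k * (r - s)) / k))"
      by (intro mult_left_mono *) auto
    also have "\<dots> = M / k * dist u v" by (simp add: exp_minus)
    finally show ?thesis .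
  qed
  have "\<exists>!v. v \<in> UNIV \<and> T v = v"
  proof (rule Banach_fix[where c = "M / k"])
    show "complete (UNIV :: (real \<Rightarrow>\<^sub>C 'a) set)" by (rule complete_UNIV)
    show "dist (T u) (T v) \<le> M / k * dist u v" for u v
      by (rule dist_bound) (use se P_contr[of "clamp s e _"] clamp_in_interval[of s e] in \<open>auto simp: T\<close>)
  qed (use k M in auto)
  then obtain v where v: "T v = v" by blast
  \<comment> \<open>Removing the weight from the fixed point equation turns it into the integral
    form of the initial value problem.\<close>
  define w where "w r = \<xi> + integral {s..r} (G v)" for r
  have w_v: "w r = exp (k * (r - s)) *\<^sub>R v r" if "r \<in> {s..e}" for r
  proof -
    have "v r = P v r" using T[of v r] v that by simp
    then show ?thesis by (simp add: P_def w_def exp_minus)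
  qed
  show thesis
  proof (rule that)
    show "w s = \<xi>" by (simp add: w_def)
    show "(w has_vector_derivative F r (w r)) (at r within {s..e})" if r: "r \<in> {s..e}" for r
    proof -
      have "(w has_vector_derivative G v r) (at r within {s..e})"
        unfolding w_def using I_deriv[of v r] r by (auto intro!: derivative_eq_intros)
      then show ?thesis using w_v[OF r] by (simp add: G_def)
    qed
  qed
qed

section \<open>Estimates from a continuous Jacobian\<close>

text \<open>The norm on matrices is the Frobenius norm, the Euclidean norm of the vector of row
  norms, so Cauchy-Schwarz applies row by row. This links continuity of the Jacobian as a matrix to
  the operator norm in the mean value inequalities.\<close>

lemma norm_matrix_vector_mul_le:
  fixes A :: "real ^ 'n ^ 'm"
  shows "norm (A *v x) \<le> norm A * norm x"
proof -
  have "norm (A *v x) \<le> L2_set (\<lambda>i. norm (A $ i) * norm x) UNIV"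
    unfolding norm_vec_def[of "A *v x"]
    by (rule L2_set_mono) (auto simp: matrix_vector_mul_component Cauchy_Schwarz_ineq2)
  also have "\<dots> = norm A * norm x"
    by (simp add: norm_vec_def[of A] L2_set_left_distrib)
  finally show ?thesis .
qed

lemma onorm_matrix_le: "onorm ((*v) A) \<le> norm (A :: real ^ 'n ^ 'm)"
  by (rule onorm_le) (rule norm_matrix_vector_mul_le)

text \<open>On the compact set \<open>T \<times> cball 0 R\<close> the Jacobian is bounded, and the
  mean value inequality on the convex ball turns this bound into a Lipschitz constant common to all
  \<open>t\<close>.\<close>

lemma lipschitz_of_jacobian_continuous:
  fixes g :: "'t::metric_space \<Rightarrow> real ^ 'n \<Rightarrow> real ^ 'm"
  assumes diff: "\<And>t x. t \<in> T \<Longrightarrow> g t differentiable (at x)"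
    and jac: "continuous_on (T \<times> UNIV) (\<lambda>(t, x). jacobian (g t) (at x))"
    and T: "compact T"
  obtains M where "M \<ge> 0" and "\<And>t x y. \<lbrakk>t \<in> T; x \<in> cball 0 R; y \<in> cball 0 R\<rbrakk> \<Longrightarrow>
    norm (g t x - g t y) \<le> M * norm (x - y)"
proof -
  have "compact ((\<lambda>(t, x). jacobian (g t) (at x)) ` (T \<times> cball 0 R))"
    by (intro compact_continuous_image continuous_on_subset[OF jac] compact_Times T) auto
  then have "\<exists>M. \<forall>t\<in>T. \<forall>x\<in>cball 0 R. norm (jacobian (g t) (at x)) \<le> M"
    by (auto dest!: compact_imp_bounded simp: bounded_iff)
  then obtain M where M: "\<And>t x. \<lbrakk>t \<in> T; x \<in> cball 0 R\<rbrakk> \<Longrightarrow> norm (jacobian (g t) (at x)) \<le> M"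
    by blast
  show thesis
  proof
    \<comment> \<open>The bound \<open>M\<close> may be negative if \<open>T\<close> or the ball is
      empty.\<close>
    show "max 0 M \<ge> 0" by simp
    fix t and x y :: "real ^ 'n" assume *: "t \<in> T" "x \<in> cball 0 R" "y \<in> cball 0 R"
    show "norm (g t x - g t y) \<le> max 0 M * norm (x - y)"
    proof (rule differentiable_bound[OF convex_cball _ _ *(2,3)])
      fix p :: "real ^ 'n" assume p: "p \<in> cball 0 R"
      show "(g t has_derivative (*v) (jacobian (g t) (at p))) (at p within cball 0 R)"
        using diff[OF *(1)] jacobian_works by (blast intro: has_derivative_at_withinI)
      show "onorm ((*v) (jacobian (g t) (at p))) \<le> max 0 M"
        using order_trans[OF onorm_matrix_le M[OF *(1) p]] by simp
    qed
  qed
qed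

text \<open>By Heine-Cantor the Jacobian is uniformly continuous on
  \<open>T \<times> cball 0 R\<close>. Hence it varies by less than \<open>\<epsilon>\<close> along
  a short segment from \<open>x\<close> to \<open>y\<close>, and the mean value inequality bounds
  the linearization error. The same \<open>\<delta>\<close> serves all times and base
  points.\<close>

lemma uniform_linearization:
  fixes g :: "'t::metric_space \<Rightarrow> real ^ 'n \<Rightarrow> real ^ 'm"
  assumes diff: "\<And>t x. t \<in> T \<Longrightarrow> g t differentiable (at x)"
    and jac: "continuous_on (T \<times> UNIV) (\<lambda>(t, x). jacobian (g t) (at x))"
    and T: "compact T"
    and eps: "\<epsilon> > 0"
  obtains \<delta> where "\<delta> > 0"
    and "\<And>t x y. \<lbrakk>t \<in> T; x \<in> cball 0 R; y \<in> cball 0 R; norm (y - x) < \<delta>\<rbrakk> \<Longrightarrow>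
      norm (g t y - g t x - jacobian (g t) (at x) *v (y - x)) \<le> \<epsilon> * norm (y - x)"
proof -
  have "uniformly_continuous_on (T \<times> cball 0 R) (\<lambda>(t, x). jacobian (g t) (at x))"
    by (intro compact_uniformly_continuous continuous_on_subset[OF jac] compact_Times T) auto
  then obtain \<delta> where \<delta>: "\<delta> > 0"
    "\<And>p q. \<lbrakk>p \<in> T \<times> cball 0 R; q \<in> T \<times> cball 0 R; dist p q < \<delta>\<rbrakk> \<Longrightarrow>
      dist (case p of (t, x) \<Rightarrow> jacobian (g t) (at x)) (case q of (t, x) \<Rightarrow> jacobian (g t) (at x)) < \<epsilon>"
    using eps unfolding uniformly_continuous_on_def by metis
  show thesis
  proof
    show "\<delta> > 0" by fact
    fix t and x y :: "real ^ 'n" assume *: "t \<in> T" "x \<in> cball 0 R" "y \<in> cball 0 R" "norm (y - x) < \<delta>"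
    let ?S = "closed_segment x y"
    have seg: "p \<in> cball 0 R" "norm (p - x) < \<delta>" if "p \<in> ?S" for p
    proof -
      show "p \<in> cball 0 R" using that * closed_segment_subset[OF _ _ convex_cball] by blast
      show "norm (p - x) < \<delta>"
        using segment_bound(1)[OF that] *(4) by linarith
    qed
    have "norm (g t y - g t x - jacobian (g t) (at x) *v (y - x)) \<le> norm (y - x) * \<epsilon>"
    proof (rule differentiable_bound_linearization[where S = ?S and f' = "\<lambda>p. (*v) (jacobian (g t) (at p))"])
      show "x + q *\<^sub>R (y - x) \<in> ?S" if "q \<in> {0..1}" for q
        using that unfolding closed_segment_def by (force simp: algebra_simps)
      fix p assume p: "p \<in> ?S"
      show "(g t has_derivative (*v) (jacobian (g t) (at p))) (at p within ?S)"
        using diff[OF *(1)] jacobian_works by (blast intro: has_derivative_at_withinI)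
      have "(*v) (jacobian (g t) (at p)) - (*v) (jacobian (g t) (at x))
          = (*v) (jacobian (g t) (at p) - jacobian (g t) (at x))"
        by (auto simp: matrix_vector_mult_diff_rdistrib)
      moreover have "norm (jacobian (g t) (at p) - jacobian (g t) (at x)) < \<epsilon>"
        using \<delta>(2)[of "(t, p)" "(t, x)"] seg[OF p] * by (simp add: dist_norm dist_Pair_Pair)
      ultimately show "onorm ((*v) (jacobian (g t) (at p)) - (*v) (jacobian (g t) (at x))) \<le> \<epsilon>"
        using order_trans[OF onorm_matrix_le less_imp_le] by metis
    qed simp
    then show "norm (g t y - g t x - jacobian (g t) (at x) *v (y - x)) \<le> \<epsilon> * norm (y - x)"
      by (simp add: mult.commute)
  qed
qed


section \<open>Uniqueness, and existence near a trajectory\<close>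

text \<open>Both solutions are continuous on a compact interval and so stay in a common ball, on
  which \<open>g\<close> is Lipschitz uniformly in time. Gronwall's inequality then applies to a
  difference that starts at zero. This makes the description in \<open>end_state\<close>
  unambiguous.\<close>

lemma ivp_unique_end:
  fixes g :: "real \<Rightarrow> real ^ 'n \<Rightarrow> real ^ 'n"
  assumes se: "s \<le> e"
    and diff: "\<And>t x. t \<in> {s..e} \<Longrightarrow> g t differentiable (at x)"
    and jac: "continuous_on ({s..e} \<times> UNIV) (\<lambda>(t, x). jacobian (g t) (at x))"
    and v: "\<And>r. r \<in> {s..e} \<Longrightarrow> (v has_vector_derivative g r (v r)) (at r within {s..e})"
    and w: "\<And>r. r \<in> {s..e} \<Longrightarrow> (w has_vector_derivative g r (w r)) (at r within {s..e})"
    and init: "v s = w s"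
  shows "v e = w e"
proof -
  have "bounded (u ` {s..e})"
    if "\<And>r. r \<in> {s..e} \<Longrightarrow> (u has_vector_derivative g r (u r)) (at r within {s..e})" for u
    using continuous_on_vector_derivative[OF that] by (intro compact_imp_bounded compact_continuous_image) auto
  then have "bounded (v ` {s..e} \<union> w ` {s..e})" using v w by simp
  then obtain R where R: "\<And>x. x \<in> v ` {s..e} \<union> w ` {s..e} \<Longrightarrow> norm x \<le> R"
    unfolding bounded_iff by blast
  obtain M where "M \<ge> 0" and M: "\<And>t x y. \<lbrakk>t \<in> {s..e}; x \<in> cball 0 R; y \<in> cball 0 R\<rbrakk> \<Longrightarrow>
      norm (g t x - g t y) \<le> M * norm (x - y)"
    using lipschitz_of_jacobian_continuous[OF diff jac compact_Icc, where R = R] by blast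
  have "norm (v e - w e) \<le> norm (v s - w s) * exp (M * (e - s))"
  proof (rule gronwall_norm[where d' = "\<lambda>r. g r (v r) - g r (w r)"])
    fix r assume r: "r \<in> {s..e}"
    show "((\<lambda>r. v r - w r) has_vector_derivative g r (v r) - g r (w r)) (at r within {s..e})"
      by (intro has_vector_derivative_diff v w r)
    show "norm (g r (v r) - g r (w r)) \<le> M * norm (v r - w r)"
      using r R[of "v r"] R[of "w r"] by (intro M) auto
  qed (use se in auto)
  then show ?thesis using init by simp
qed

text \<open>Outside a large ball \<open>g\<close> may be replaced by a globally Lipschitz field.\<close>

lemma ivp_exists_near_trajectory:
  fixes g :: "real \<Rightarrow> real ^ 'n \<Rightarrow> real ^ 'n"
  assumes se: "s \<le> e"
    and cont: "continuous_on ({s..e} \<times> UNIV) (\<lambda>(t, x). g t x)"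
    and diff: "\<And>t x. t \<in> {s..e} \<Longrightarrow> g t differentiable (at x)"
    and jac: "continuous_on ({s..e} \<times> UNIV) (\<lambda>(t, x). jacobian (g t) (at x))"
    and z: "\<And>r. r \<in> {s..e} \<Longrightarrow> (z has_vector_derivative g r (z r)) (at r within {s..e})"
  obtains C \<rho> where "C > 0" "\<rho> > 0"
    and "\<And>x. norm (x - z s) \<le> \<rho> \<Longrightarrow>
      \<exists>w. w s = x \<and>
        (\<forall>r\<in>{s..e}. (w has_vector_derivative g r (w r)) (at r within {s..e})) \<and>
        (\<forall>r\<in>{s..e}. norm (w r - z r) \<le> C * norm (x - z s))"
proof -
  have "bounded (z ` {s..e})"
    using continuous_on_vector_derivative[OF z]
    by (intro compact_imp_bounded compact_continuous_image) auto
  then obtain R0 where R0: "\<And>r. r \<in> {s..e} \<Longrightarrow> norm (z r) \<le> R0"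
    unfolding bounded_iff by blast
  \<comment> \<open>The extra 1 leaves room around the trajectory: every state within distance 1 of
    it lies in the ball where \<open>F\<close> agrees with \<open>g\<close>.\<close>
  define R where "R = R0 + 1"
  \<comment> \<open>Projection onto a closed convex set does not increase distances, so
    \<open>F\<close> inherits on the whole space the Lipschitz constant that \<open>g\<close> has on
    the ball.\<close>
  define F where "F r x = g r (closest_point (cball 0 R) x)" for r x
  have ball: "cball 0 R \<noteq> ({} :: (real ^ 'n) set)"
    using order_trans[OF norm_ge_zero R0[of s]] se by (simp add: R_def)
  have F_eq: "F r x = g r x" if "norm x \<le> R" for r x
    using that by (simp add: F_def closest_point_self)
  obtain M where M: "M \<ge> 0" "\<And>t x y. \<lbrakk>t \<in> {s..e}; x \<in> cball 0 R; y \<in> cball 0 R\<rbrakk> \<Longrightarrow>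
      norm (g t x - g t y) \<le> M * norm (x - y)"
    using lipschitz_of_jacobian_continuous[OF diff jac compact_Icc, where R = R] by blast
  have F_lip: "norm (F r x - F r y) \<le> M * norm (x - y)" if "r \<in> {s..e}" for r x y
  proof -
    have "norm (F r x - F r y)
        \<le> M * norm (closest_point (cball 0 R) x - closest_point (cball 0 R) y)"
      unfolding F_def using ball by (intro M(2) that closest_point_in_set) auto
    also have "\<dots> \<le> M * norm (x - y)"
      using closest_point_lipschitz[OF convex_cball closed_cball ball, of x y] M(1)
      by (intro mult_left_mono) (auto simp: dist_norm)
    finally show ?thesis .
  qed
  have F_cont: "continuous_on ({s..e} \<times> UNIV) (\<lambda>(t, x). F t x)"
  proof -
    have "continuous_on ({s..e} \<times> UNIV) (\<lambda>p. closest_point (cball 0 R) (snd p :: real ^ 'n))"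
      by (rule continuous_on_compose2[OF continuous_on_closest_point[OF convex_cball closed_cball ball, of UNIV]])
        (auto intro!: continuous_intros)
    then have "continuous_on ({s..e} \<times> UNIV) (\<lambda>p. (fst p, closest_point (cball 0 R) (snd p :: real ^ 'n)))"
      by (intro continuous_intros)
    then show ?thesis
      unfolding F_def using continuous_on_compose2[OF cont] by (fastforce simp: case_prod_unfold)
  qed
  define C where "C = exp (M * (e - s))"
  have C: "C > 0" by (simp add: C_def)
  show thesis
  \<comment> \<open>As \<open>C\<close> bounds the Gronwall growth factor, an initial deviation of
    at most \<open>1 / C\<close> keeps the solution for \<open>F\<close> within 1 of
    \<open>z\<close>, where it also solves the equation for \<open>g\<close>.\<close>
  proof (rule that[OF C, of "1 / C"])
    show "1 / C > 0" using C by simp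
    fix x assume x: "norm (x - z s) \<le> 1 / C"
    obtain w where w: "w s = x"
      "\<And>r. r \<in> {s..e} \<Longrightarrow> (w has_vector_derivative F r (w r)) (at r within {s..e})"
      using ivp_exists_lipschitz[OF se F_cont F_lip M(1)] by metis
    have close: "norm (w r - z r) \<le> C * norm (x - z s)" if r: "r \<in> {s..e}" for r
    proof -
      have "norm (w r - z r) \<le> norm (w s - z s) * exp (M * (r - s))"
      proof (rule gronwall_norm[where d' = "\<lambda>r. F r (w r) - F r (z r)"])
        fix q assume q: "q \<in> {s..e}"
        have "F q (z q) = g q (z q)"
          using R0[OF q] by (intro F_eq) (simp add: R_def)
        then show "((\<lambda>r. w r - z r) has_vector_derivative F q (w q) - F q (z q)) (at q within {s..e})"
          using z[OF q] w(2)[OF q] by (auto intro: has_vector_derivative_diff)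
        show "norm (F q (w q) - F q (z q)) \<le> M * norm (w q - z q)"
          by (rule F_lip[OF q])
      qed (rule r)
      also have "\<dots> \<le> norm (w s - z s) * C"
        using M(1) r by (intro mult_left_mono) (auto simp: C_def intro!: mult_left_mono)
      finally show ?thesis by (simp add: w(1) mult.commute)
    qed
    have "F r (w r) = g r (w r)" if r: "r \<in> {s..e}" for r
    proof (rule F_eq)
      have "C * norm (x - z s) \<le> 1" using x C by (simp add: field_simps)
      then have "norm (w r - z r) \<le> 1" using close[OF r] by linarith
      then show "norm (w r) \<le> R"
        using R0[OF r] norm_triangle_sub[of "w r" "z r"] by (simp add: R_def)
    qed
    then show "\<exists>w. w s = x \<and>
        (\<forall>r\<in>{s..e}. (w has_vector_derivative g r (w r)) (at r within {s..e})) \<and>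
        (\<forall>r\<in>{s..e}. norm (w r - z r) \<le> C * norm (x - z s))"
      using w close by (intro exI[of _ w]) auto
  qed
qed

section \<open>The pairing of the adjoint with a deviation\<close>

text \<open>The Jacobian enters the derivative of the pairing twice, through the adjoint equation
  and through the linearization of \<open>g\<close>, with opposite signs. What survives is
  \<open>a r\<close> paired with the linearization error, to which the mean value inequality
  applies.\<close>

lemma adjoint_pairing_bound:
  fixes g :: "real \<Rightarrow> real ^ 'n \<Rightarrow> real ^ 'n"
  assumes se: "s \<le> e"
    and a: "\<And>r. r \<in> {s..e} \<Longrightarrow>
      (a has_vector_derivative - (a r v* jacobian (g r) (at (z r)))) (at r within {s..e})"
    and z: "\<And>r. r \<in> {s..e} \<Longrightarrow> (z has_vector_derivative g r (z r)) (at r within {s..e})"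
    and w: "\<And>r. r \<in> {s..e} \<Longrightarrow> (w has_vector_derivative g r (w r)) (at r within {s..e})"
    and A: "\<And>r. r \<in> {s..e} \<Longrightarrow> norm (a r) \<le> A"
    and rem: "\<And>r. r \<in> {s..e} \<Longrightarrow>
      norm (g r (w r) - g r (z r) - jacobian (g r) (at (z r)) *v (w r - z r)) \<le> B"
  shows "\<bar>a e \<bullet> (w e - z e) - a s \<bullet> (w s - z s)\<bar> \<le> A * B * (e - s)"
proof -
  define D where "D r = g r (w r) - g r (z r) - jacobian (g r) (at (z r)) *v (w r - z r)" for r
  have "norm (a e \<bullet> (w e - z e) - a s \<bullet> (w s - z s)) \<le> A * B * norm (e - s)"
  proof (rule field_differentiable_bound[where S = "{s..e}" and f = "\<lambda>r. a r \<bullet> (w r - z r)" and f' = "\<lambda>r. a r \<bullet> D r"])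
    fix r assume r: "r \<in> {s..e}"
    have "((\<lambda>r. a r \<bullet> (w r - z r)) has_vector_derivative
        a r \<bullet> (g r (w r) - g r (z r)) + - (a r v* jacobian (g r) (at (z r))) \<bullet> (w r - z r))
        (at r within {s..e})"
      by (rule bounded_bilinear.has_vector_derivative[OF bounded_bilinear_inner a[OF r]
        has_vector_derivative_diff[OF w[OF r] z[OF r]]])
    then show "((\<lambda>r. a r \<bullet> (w r - z r)) has_field_derivative a r \<bullet> D r) (at r within {s..e})"
      by (simp add: D_def has_real_derivative_iff_has_vector_derivative dot_lmul_matrix
        inner_diff_right matrix_vector_mult_diff_distrib algebra_simps)
    have "norm (a r \<bullet> D r) \<le> norm (a r) * norm (D r)"
      by (simp add: Cauchy_Schwarz_ineq2)
    also have "\<dots> \<le> A * B"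
      using A[OF r] rem[OF r] order_trans[OF norm_ge_zero A[OF r]]
      unfolding D_def by (intro mult_mono) auto
    finally show "norm (a r \<bullet> D r) \<le> A * B" .
  qed (use se in auto)
  then show ?thesis using se by simp
qed

section \<open>Row derivatives and end states\<close>

lemma row_derivative_eqI:
  assumes "(h has_derivative (\<lambda>y. v \<bullet> y)) (at x)"
  shows "row_derivative h x = v"
proof -
  have "frechet_derivative h (at x) = (\<lambda>y. v \<bullet> y)"
    using frechet_derivative_at[OF assms] by (rule sym)
  then show ?thesis
    unfolding row_derivative_def by (simp add: inner_axis)
qed

text \<open>A linear functional is determined by its values on the standard basis, and these are the
  entries of the row.\<close>

lemma has_derivative_row_derivative:
  assumes "h differentiable (at x)"
  shows "(h has_derivative (\<lambda>y. row_derivative h x \<bullet> y)) (at x)"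
proof -
  let ?D = "frechet_derivative h (at x)"
  have D: "(h has_derivative ?D) (at x)" using assms by (simp add: frechet_derivative_works)
  have "?D y = row_derivative h x \<bullet> y" for y
  proof -
    have "?D y = ?D (\<Sum>j\<in>UNIV. y $ j *\<^sub>R axis j 1)"
      using basis_expansion[of y] by (simp add: scalar_mult_eq_scaleR)
    also have "\<dots> = (\<Sum>j\<in>UNIV. y $ j * ?D (axis j 1))"
      using has_derivative_linear[OF D] by (simp add: linear_sum linear_scale)
    finally show ?thesis by (simp add: row_derivative_def inner_vec_def mult.commute)
  qed
  then have "?D = (\<lambda>y. row_derivative h x \<bullet> y)" by blast
  then show ?thesis using D by simp
qed

lemma end_state_eqI:
  assumes w: "solves_ivp f \<theta> s e x w"
    and unique: "\<And>v. solves_ivp f \<theta> s e x v \<Longrightarrow> v e = w e"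
  shows "end_state f \<theta> s e x = w e"
  unfolding end_state_def by (rule the_equality) (use w unique in blast)+

section \<open>The derivative of the cost with respect to the state\<close>

text \<open>For a solution \<open>w\<close> from \<open>x\<close>, the error of the claimed
  linearization is \<open>L (w e) - L (z e) + a e \<bullet> (w e - z e)\<close> minus
  \<open>a e \<bullet> (w e - z e) - a s \<bullet> (x - z s)\<close>. Differentiability of
  \<open>L\<close> controls the first term and the adjoint pairing the second, each by
  \<open>\<epsilon> / 2 * norm (x - z s)\<close>.\<close>

lemma has_derivative_cost_from_state:
  fixes f :: "real \<Rightarrow> real ^ 'n \<Rightarrow> real ^ 'p \<Rightarrow> real ^ 'n"
  assumes se: "s \<le> e"
    and \<theta>: "\<And>t. t \<in> {s..e} \<Longrightarrow> \<theta> t = p"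
    and cont: "continuous_on ({s..e} \<times> UNIV) (\<lambda>(t, x). f t x p)"
    and diff: "\<And>t x. t \<in> {s..e} \<Longrightarrow> (\<lambda>y. f t y p) differentiable (at x)"
    and jac: "continuous_on ({s..e} \<times> UNIV) (\<lambda>(t, x). jacobian (\<lambda>y. f t y p) (at x))"
    and z: "solves_ivp f \<theta> s e (z s) z"
    and L: "(L has_derivative (\<lambda>h. - (a e \<bullet> h))) (at (z e))"
    and a: "\<And>r. r \<in> {s..e} \<Longrightarrow>
      (a has_vector_derivative - (a r v* jacobian (\<lambda>y. f r y p) (at (z r)))) (at r within {s..e})"
  shows "(cost_from_state f \<theta> L e s has_derivative (\<lambda>h. - (a s \<bullet> h))) (at (z s))"
proof -
  define g where "g t x = f t x p" for t x
  note cont = cont[folded g_def] and diff = diff[folded g_def] and jac = jac[folded g_def]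
    and a = a[folded g_def]
  have ivp_iff: "solves_ivp f \<theta> s e x w \<longleftrightarrow>
      w s = x \<and> (\<forall>r\<in>{s..e}. (w has_vector_derivative g r (w r)) (at r within {s..e}))" for x w
    using \<theta> by (simp add: solves_ivp_def g_def)
  have z': "\<And>r. r \<in> {s..e} \<Longrightarrow> (z has_vector_derivative g r (z r)) (at r within {s..e})"
    using z ivp_iff by blast
  have end_eq: "end_state f \<theta> s e x = w e" if "solves_ivp f \<theta> s e x w" for x w
    by (rule end_state_eqI[OF that], rule ivp_unique_end[OF se diff jac])
      (use that in \<open>auto simp: ivp_iff\<close>)
  obtain C \<rho> where C: "C > 0" and \<rho>: "\<rho> > 0" and near: "\<And>x. norm (x - z s) \<le> \<rho> \<Longrightarrow>
      \<exists>w. w s = x \<and>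
        (\<forall>r\<in>{s..e}. (w has_vector_derivative g r (w r)) (at r within {s..e})) \<and>
        (\<forall>r\<in>{s..e}. norm (w r - z r) \<le> C * norm (x - z s))"
    using ivp_exists_near_trajectory[OF se cont diff jac z'] by blast
  have "bounded (z ` {s..e})" "bounded (a ` {s..e})"
    using continuous_on_vector_derivative[OF z'] continuous_on_vector_derivative[OF a]
    by (auto intro!: compact_imp_bounded compact_continuous_image)
  then obtain R A where R: "\<And>r. r \<in> {s..e} \<Longrightarrow> norm (z r) \<le> R"
    and A: "\<And>r. r \<in> {s..e} \<Longrightarrow> norm (a r) \<le> A"
    unfolding bounded_iff by blast
  have A0: "A \<ge> 0" using order_trans[OF norm_ge_zero A[of s]] se by simp
  show ?thesis
    unfolding has_derivative_at_alt
  proof (intro conjI allI impI)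
    show "bounded_linear (\<lambda>h. - (a s \<bullet> h))"
      by (intro bounded_linear_minus bounded_linear_inner_right)
    fix \<epsilon> :: real assume \<epsilon>: "\<epsilon> > 0"
    \<comment> \<open>The pairing drifts by at most \<open>A * C * (e - s) * \<eta>\<close> times
      the initial deviation, and \<open>\<eta>\<close> makes this factor at most
      \<open>\<epsilon> / 2\<close>. The summand 1 keeps the denominator positive when
      \<open>A = 0\<close> or \<open>s = e\<close>.\<close>
    define \<eta> where "\<eta> = \<epsilon> / (2 * (A * C * (e - s) + 1))"
    have pos: "A * C * (e - s) + 1 > 0" using A0 C se by (simp add: add_nonneg_pos)
    have \<eta>: "\<eta> > 0" "A * C * (e - s) * \<eta> \<le> \<epsilon> / 2"
      using \<epsilon> pos by (simp_all add: \<eta>_def field_simps)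
    obtain \<delta>1 where \<delta>1: "\<delta>1 > 0"
      "\<And>t x y. \<lbrakk>t \<in> {s..e}; x \<in> cball 0 (R + 1); y \<in> cball 0 (R + 1); norm (y - x) < \<delta>1\<rbrakk> \<Longrightarrow>
        norm (g t y - g t x - jacobian (g t) (at x) *v (y - x)) \<le> \<eta> * norm (y - x)"
      using uniform_linearization[OF diff jac compact_Icc \<eta>(1)] by metis
    \<comment> \<open>The factor \<open>C\<close> will cancel against the growth of the deviation up
      to time \<open>e\<close>.\<close>
    have "\<epsilon> / (2 * C) > 0" using \<epsilon> C by simp
    then obtain \<delta>2 where \<delta>2: "\<delta>2 > 0" "\<And>y. norm (y - z e) < \<delta>2 \<Longrightarrow>
        norm (L y - L (z e) - - (a e \<bullet> (y - z e))) \<le> \<epsilon> / (2 * C) * norm (y - z e)"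
      using L unfolding has_derivative_at_alt by blast
    \<comment> \<open>The bound \<open>\<rho>\<close> provides the solution \<open>w\<close>.
      Division by \<open>C\<close> ensures that \<open>w\<close> stays within 1 of \<open>z\<close>,
      hence in the ball of radius \<open>R + 1\<close>, within \<open>\<delta>1\<close> for the
      linearization, and within \<open>\<delta>2\<close> at the end for \<open>L\<close>.\<close>
    define \<delta> where "\<delta> = min \<rho> (min 1 (min \<delta>1 \<delta>2) / C)"
    have "\<delta> > 0" using \<rho> C \<delta>1(1) \<delta>2(1) by (simp add: \<delta>_def)
    moreover have "norm (cost_from_state f \<theta> L e s x - cost_from_state f \<theta> L e s (z s) - - (a s \<bullet> (x - z s)))
        \<le> \<epsilon> * norm (x - z s)" if x: "norm (x - z s) < \<delta>" for x
    proof -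
      have "norm (x - z s) \<le> \<rho>" using x by (simp add: \<delta>_def)
      then obtain w where w: "w s = x"
        "\<And>r. r \<in> {s..e} \<Longrightarrow> (w has_vector_derivative g r (w r)) (at r within {s..e})"
        "\<And>r. r \<in> {s..e} \<Longrightarrow> norm (w r - z r) \<le> C * norm (x - z s)"
        using near by blast
      have "C * norm (x - z s) < min 1 (min \<delta>1 \<delta>2)"
        using x C by (simp add: \<delta>_def field_simps)
      then have small: "norm (w r - z r) < 1" "norm (w r - z r) < \<delta>1" "norm (w r - z r) < \<delta>2"
        if "r \<in> {s..e}" for r
        using w(3)[OF that] by auto
      have "\<bar>a e \<bullet> (w e - z e) - a s \<bullet> (w s - z s)\<bar> \<le> A * (\<eta> * (C * norm (x - z s))) * (e - s)"
      proof (rule adjoint_pairing_bound[OF se a z' w(2) A])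
        fix r assume r: "r \<in> {s..e}"
        have "norm (w r) \<le> R + 1"
          using R[OF r] small(1)[OF r] norm_triangle_sub[of "w r" "z r"] by linarith
        then have "norm (g r (w r) - g r (z r) - jacobian (g r) (at (z r)) *v (w r - z r))
            \<le> \<eta> * norm (w r - z r)"
          using R[OF r] by (intro \<delta>1(2) r small) auto
        also have "\<dots> \<le> \<eta> * (C * norm (x - z s))"
          using \<eta>(1) w(3)[OF r] by (intro mult_left_mono) auto
        finally show "norm (g r (w r) - g r (z r) - jacobian (g r) (at (z r)) *v (w r - z r))
            \<le> \<eta> * (C * norm (x - z s))" .
      qed
      also have "\<dots> = A * C * (e - s) * \<eta> * norm (x - z s)" by (simp add: mult_ac)
      also have "\<dots> \<le> \<epsilon> / 2 * norm (x - z s)" by (intro mult_right_mono \<eta>(2)) auto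
      finally have pairing: "\<bar>a e \<bullet> (w e - z e) - a s \<bullet> (x - z s)\<bar> \<le> \<epsilon> / 2 * norm (x - z s)"
        by (simp add: w(1))
      have e: "e \<in> {s..e}" using se by simp
      have "norm (L (w e) - L (z e) - - (a e \<bullet> (w e - z e))) \<le> \<epsilon> / (2 * C) * norm (w e - z e)"
        by (rule \<delta>2(2)[OF small(3)[OF e]])
      also have "\<dots> \<le> \<epsilon> / (2 * C) * (C * norm (x - z s))"
        using \<epsilon> C w(3)[OF e] by (intro mult_left_mono) auto
      also have "\<dots> = \<epsilon> / 2 * norm (x - z s)" using C by simp
      finally have cost: "\<bar>L (w e) - L (z e) + a e \<bullet> (w e - z e)\<bar> \<le> \<epsilon> / 2 * norm (x - z s)"
        by simp
      have "end_state f \<theta> s e x = w e" using w by (intro end_eq) (auto simp: ivp_iff)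
      moreover have "end_state f \<theta> s e (z s) = z e" by (rule end_eq[OF z])
      ultimately show ?thesis
        using pairing cost by (simp only: cost_from_state_def real_norm_def)
    qed
    ultimately show "\<exists>d>0. \<forall>y. norm (y - z s) < d \<longrightarrow>
        norm (cost_from_state f \<theta> L e s y - cost_from_state f \<theta> L e s (z s) - - (a s \<bullet> (y - z s)))
        \<le> \<epsilon> * norm (y - z s)"
      by blast
  qed
qed

theorem lemma2:
  fixes f :: "real \<Rightarrow> real ^ 'n \<Rightarrow> real ^ 'p \<Rightarrow> real ^ 'n"
    and L :: "real ^ 'n \<Rightarrow> real"
    and t0 tf :: real
    and z0 :: "real ^ 'n"
    and \<theta> :: "real \<Rightarrow> real ^ 'p"
    and \<theta>0 :: "real ^ 'p"
    and z a :: "real \<Rightarrow> real ^ 'n"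
  assumes time: "t0 < tf"
    and f_cont: "continuous_on ({t0..tf} \<times> UNIV) (\<lambda>(t, x). f t x \<theta>0)"
    and f_diff: "\<And>t x. t \<in> {t0..tf} \<Longrightarrow> (\<lambda>y. f t y \<theta>0) differentiable (at x)"
    and f_jac_cont:
      "continuous_on ({t0..tf} \<times> UNIV) (\<lambda>(t, x). jacobian (\<lambda>y. f t y \<theta>0) (at x))"
    and \<theta>_const: "\<And>t. t \<in> {t0..tf} \<Longrightarrow> \<theta> t = \<theta>0"
    and trajectory: "solves_ivp f \<theta> t0 tf z0 z"
    and L_diff: "L differentiable (at (z tf))"
    and adjoint:
      "\<And>t. t \<in> {t0..tf} \<Longrightarrow>
        (a has_vector_derivative - (a t v* jacobian (\<lambda>y. f t y (\<theta> t)) (at (z t))))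
          (at t within {t0..tf})"
    and adjoint_end: "a tf = - row_derivative L (z tf)"
  shows "\<forall>t\<in>{t0..tf}.
      cost_from_state f \<theta> L tf t differentiable (at (z t)) \<and>
      a t = - row_derivative (cost_from_state f \<theta> L tf t) (z t)"
proof
  fix t assume t: "t \<in> {t0..tf}"
  \<comment> \<open>Trajectory and adjoint still solve their equations on the remaining interval, so
    \<open>t\<close> can serve as the initial time. For \<open>t = tf\<close> this interval is a
    single point.\<close>
  then have sub: "{t..tf} \<subseteq> {t0..tf}" by auto
  have "(cost_from_state f \<theta> L tf t has_derivative (\<lambda>h. - (a t \<bullet> h))) (at (z t))"
  proof (rule has_derivative_cost_from_state[where p = \<theta>0])
    show "t \<le> tf" using t by simp
    show "continuous_on ({t..tf} \<times> UNIV) (\<lambda>(t, x). f t x \<theta>0)"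
      by (rule continuous_on_subset[OF f_cont]) (use sub in auto)
    show "continuous_on ({t..tf} \<times> UNIV) (\<lambda>(t, x). jacobian (\<lambda>y. f t y \<theta>0) (at x))"
      by (rule continuous_on_subset[OF f_jac_cont]) (use sub in auto)
    show "solves_ivp f \<theta> t tf (z t) z"
      using trajectory sub
      by (auto simp: solves_ivp_def intro!: has_vector_derivative_within_subset[OF _ sub])
    show "(L has_derivative (\<lambda>h. - (a tf \<bullet> h))) (at (z tf))"
      using has_derivative_row_derivative[OF L_diff] by (simp add: adjoint_end)
    show "\<theta> r = \<theta>0" "(\<lambda>y. f r y \<theta>0) differentiable (at x)" if "r \<in> {t..tf}" for r x
      using that sub \<theta>_const f_diff by auto
    show "(a has_vector_derivative - (a r v* jacobian (\<lambda>y. f r y \<theta>0) (at (z r)))) (at r within {t..tf})"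
      if "r \<in> {t..tf}" for r
      using adjoint[of r] \<theta>_const[of r] that sub
      by (auto intro!: has_vector_derivative_within_subset[OF _ sub])
  qed
  \<comment> \<open>With the sign moved onto the vector, the derivative has the form from which its
    row can be read off.\<close>
  then have "(cost_from_state f \<theta> L tf t has_derivative (\<lambda>h. (- a t) \<bullet> h)) (at (z t))"
    by simp
  from this row_derivative_eqI[OF this]
  show "cost_from_state f \<theta> L tf t differentiable (at (z t)) \<and>
      a t = - row_derivative (cost_from_state f \<theta> L tf t) (z t)"
    by (auto simp: differentiable_def)
qed

end
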